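(* Let $n\ge 2$ and let $(X,K)$ be an $n$-dimensional partially ordered real vector space, where $K$ is a closed generating cone. Then the number of bands in $(X,K)$ does not exceed $$\tfrac14\,2^{2^{n}}.$$
   Context: A cone $K$ in a real vector space $X$ is a subset closed under addition and multiplication by nonnegative scalars with $K\cap(-K)=\{0\}$; $(X,K)$ denotes $X$ partially ordered by $x\le y$ iff $y-x\in K$. $K$ is generating if $X=K-K$. For $M\subseteq X$, $M^u$ is the set of upper bounds of $M$ in $X$. Elements $x,y\in X$ are disjoint, $x\perp y$, if $\{x+y,-x-y\}^u=\{x-y,-x+y\}^u$. The disjoint complement of $M\subseteq X$ is $M^d=\{y\in X\colon x\perp y\text{ for all }x\in M\}$. A linear subspace $B\subseteq X$ is a band if $(B^d)^d=B$. *)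

theory Defs
  imports "HOL-Analysis.Analysis"
begin

text \<open>The library predicate \<^const>\<open>cone\<close> only expresses closure under multiplication by
  nonnegative scalars. The last conjunct forces \<open>0 \<in> K\<close> and makes the order antisymmetric.\<close>

definition ordering_cone :: "'a::real_vector set \<Rightarrow> bool" where
  "ordering_cone K \<longleftrightarrow>
     (\<forall>x\<in>K. \<forall>y\<in>K. x + y \<in> K) \<and> cone K \<and> K \<inter> uminus ` K = {0}"

definition generating :: "'a::real_vector set \<Rightarrow> bool" where
  "generating K \<longleftrightarrow> {x - y | x y. x \<in> K \<and> y \<in> K} = UNIV"

definition cone_le :: "'a::real_vector set \<Rightarrow> 'a \<Rightarrow> 'a \<Rightarrow> bool" where
  "cone_le K x y \<longleftrightarrow> y - x \<in> K"

definition upper_bounds :: "'a::real_vector set \<Rightarrow> 'a set \<Rightarrow> 'a set" where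
  "upper_bounds K M = {z. \<forall>x\<in>M. cone_le K x z}"

definition disjoint_elems :: "'a::real_vector set \<Rightarrow> 'a \<Rightarrow> 'a \<Rightarrow> bool" where
  "disjoint_elems K x y \<longleftrightarrow>
     upper_bounds K {x + y, - x - y} = upper_bounds K {x - y, - x + y}"

definition disjoint_complement :: "'a::real_vector set \<Rightarrow> 'a set \<Rightarrow> 'a set" where
  "disjoint_complement K M = {y. \<forall>x\<in>M. disjoint_elems K x y}"

definition band :: "'a::real_vector set \<Rightarrow> 'a set \<Rightarrow> bool" where
  "band K B \<longleftrightarrow> subspace B \<and> disjoint_complement K (disjoint_complement K B) = B"

end

theory Submission
  imports Defs
begin

text \<open>Let \<open>\<Lambda>\<close> be the set of extremal functionals of the dual cone. Two elements are disjoint iff no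
  functional in \<open>\<Lambda>\<close> is nonzero on both, so for a band \<open>B\<close> the set \<open>\<Lambda>\<close> is covered by the annihilators
  of \<open>B\<close> and \<open>B\<^sup>d\<close>, and \<open>B\<close> is the common kernel of the functionals in \<open>\<Lambda>\<close> that do not vanish on
  \<open>B\<^sup>d\<close>. Splitting \<open>\<Lambda>\<close> repeatedly along such pairs of annihilators lowers the dimension of the span
  each time, so at most \<open>2\<^bsup>n-1\<^esup>\<close> pieces arise before every piece lies in one member of each pair.
  A band is then determined by the set of pieces not contained in the annihilator of \<open>B\<^sup>d\<close>, whence
  there are at most \<open>2\<^bsup>2\<^bsup>n-1\<^esup>\<^esup>\<close> bands, which is at most the claimed bound for \<open>n \<ge> 2\<close>.\<close>

section \<open>The dual cone and its extremal functionals\<close>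

text \<open>Functionals are represented by vectors through the inner product, so the dual cone lies
  in the space itself.\<close>

definition dual_cone :: "'a::real_inner set \<Rightarrow> 'a set" where
  "dual_cone K = {c. \<forall>x\<in>K. 0 \<le> c \<bullet> x}"

text \<open>These are the vectors on the extreme rays of the dual cone; for generating
  \<open>K\<close> the vector 0 belongs to them as well.\<close>

definition extremal_functionals :: "'a::real_inner set \<Rightarrow> 'a set" where
  "extremal_functionals K =
     {f \<in> dual_cone K. \<forall>c \<in> dual_cone K. f - c \<in> dual_cone K \<longrightarrow> (\<exists>t\<ge>0. c = t *\<^sub>R f)}"

lemma ordering_coneD:
  assumes "ordering_cone K"
  shows "0 \<in> K" and "x \<in> K \<Longrightarrow> y \<in> K \<Longrightarrow> x + y \<in> K" and "x \<in> K \<Longrightarrow> 0 \<le> t \<Longrightarrow> t *\<^sub>R x \<in> K"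
  using assms by (auto simp: ordering_cone_def cone_def)

lemma ordering_cone_convex: "ordering_cone K \<Longrightarrow> convex K"
  using convex_cone unfolding ordering_cone_def cone_def by blast

lemma dual_cone_scaleR: "c \<in> dual_cone K \<Longrightarrow> 0 \<le> t \<Longrightarrow> t *\<^sub>R c \<in> dual_cone K"
  by (simp add: dual_cone_def)

lemma closed_dual_cone: "closed (dual_cone (K :: 'a::euclidean_space set))"
proof -
  have "dual_cone K = (\<Inter>x\<in>K. {c. 0 \<le> c \<bullet> x})"
    by (auto simp: dual_cone_def)
  moreover have "closed {c. 0 \<le> c \<bullet> x}" for x :: 'a
    by (intro closed_Collect_le continuous_intros)
  ultimately show ?thesis
    by auto
qed

lemma convex_dual_cone: "convex (dual_cone K)"
  by (auto simp: convex_def dual_cone_def inner_add_left)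

lemma dual_cone_separates:
  fixes K :: "'a::euclidean_space set"
  assumes "ordering_cone K" "closed K" "x \<notin> K"
  shows "\<exists>c \<in> dual_cone K. c \<bullet> x < 0"
proof -
  obtain a b where ab: "a \<bullet> x < b" "\<And>y. y \<in> K \<Longrightarrow> b < a \<bullet> y"
    using separating_hyperplane_closed_point[of K x] assms ordering_cone_convex by metis
  have b0: "b < 0"
    using ab(2)[OF ordering_coneD(1)[OF assms(1)]] by simp
  have "0 \<le> a \<bullet> y" if "y \<in> K" for y
  proof (rule ccontr)
    assume "\<not> 0 \<le> a \<bullet> y"
    then have neg: "a \<bullet> y < 0"
      by simp
    \<comment> \<open>The multiple of \<open>y\<close> at which \<open>a\<close> takes the value
      \<open>b\<close> exactly, against the strict inequality on \<open>K\<close>.\<close>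
    then have "(b / (a \<bullet> y)) *\<^sub>R y \<in> K"
      using ordering_coneD(3)[OF assms(1) that] b0 by (simp add: divide_nonpos_neg)
    from ab(2)[OF this] neg show False
      by simp
  qed
  then have "a \<in> dual_cone K"
    by (simp add: dual_cone_def)
  then show ?thesis
    using ab(1) b0 by force
qed

lemma generating_orthogonal_eq_0:
  assumes "generating K" "\<And>x. x \<in> K \<Longrightarrow> c \<bullet> x = 0"
  shows "c = 0"
proof -
  have "c \<in> {x - y | x y. x \<in> K \<and> y \<in> K}"
    using assms(1) by (simp add: generating_def)
  then obtain x y where "c = x - y" "x \<in> K" "y \<in> K"
    by blast
  then have "c \<bullet> c = 0"
    using assms(2) by (metis inner_diff_right diff_self)
  then show ?thesis
    by simp
qed

section \<open>Compact base of the dual cone and its extreme points\<close>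

lemma dual_cone_antisym:
  assumes "generating K" "c \<in> dual_cone K" "- c \<in> dual_cone K"
  shows "c = 0"
  using assms by (intro generating_orthogonal_eq_0[of K]) (force simp: dual_cone_def)+

text \<open>Take the sum of a finite subset of \<open>K\<close> that spans \<open>K\<close>: a
  functional of the dual cone vanishing on the sum vanishes on every summand, hence on
  \<open>K\<close>, hence everywhere. The vector \<open>u\<close> serves to cut a base out of the
  dual cone.\<close>

lemma exists_strictly_positive:
  fixes K :: "'a::euclidean_space set"
  assumes "ordering_cone K" "generating K"
  shows "\<exists>u\<in>K. \<forall>c \<in> dual_cone K. c \<noteq> 0 \<longrightarrow> 0 < c \<bullet> u"
proof -
  obtain S where S: "S \<subseteq> K" "finite S" "K \<subseteq> span S"
    by (metis basis_exists finiteI_independent)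
  have "\<Sum>S \<in> K"
    using S(2,1) by (induction) (auto simp: ordering_coneD[OF assms(1)])
  moreover have "0 < c \<bullet> \<Sum>S" if c: "c \<in> dual_cone K" "c \<noteq> 0" for c
  proof (rule ccontr)
    assume "\<not> 0 < c \<bullet> \<Sum>S"
    moreover have nn: "\<And>s. s \<in> S \<Longrightarrow> 0 \<le> c \<bullet> s"
      using c S(1) by (auto simp: dual_cone_def)
    ultimately have "(\<Sum>s\<in>S. c \<bullet> s) = 0"
      by (simp add: inner_sum_right order_antisym sum_nonneg)
    then have "\<And>s. s \<in> S \<Longrightarrow> c \<bullet> s = 0"
      using nn S(2) by (simp add: sum_nonneg_eq_0_iff)
    then have "\<And>x. x \<in> span S \<Longrightarrow> orthogonal c x"
      using orthogonal_to_span orthogonal_def by blast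
    then show False
      using generating_orthogonal_eq_0[OF assms(2)] S(3) c(2)
      by (metis orthogonal_def subsetD)
  qed
  ultimately show ?thesis
    by blast
qed

text \<open>On the unit vectors of the dual cone the value at \<open>u\<close> has a positive
  minimum, and its reciprocal bounds the norm on the base. If there are no such unit vectors, the
  dual cone is trivial and the base is empty.\<close>

lemma compact_dual_cone_base:
  fixes K :: "'a::euclidean_space set"
  assumes pos: "\<And>c. c \<in> dual_cone K \<Longrightarrow> c \<noteq> 0 \<Longrightarrow> 0 < c \<bullet> u"
  shows "compact {c \<in> dual_cone K. c \<bullet> u = 1}"
proof (cases "dual_cone K \<inter> sphere 0 1 = {}")
  case True
  have "c = 0" if "c \<in> dual_cone K" for c
  proof (rule ccontr)
    assume "c \<noteq> 0"
    then have "(1 / norm c) *\<^sub>R c \<in> dual_cone K \<inter> sphere 0 1"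
      using dual_cone_scaleR[OF that, of "1 / norm c"] by simp
    then show False
      using True by blast
  qed
  then have "{c \<in> dual_cone K. c \<bullet> u = 1} = {}"
    by force
  then show ?thesis
    by (metis compact_empty)
next
  case False
  have "compact (dual_cone K \<inter> sphere 0 1)"
    by (simp add: closed_Int_compact closed_dual_cone)
  moreover have "continuous_on (dual_cone K \<inter> sphere 0 1) (\<lambda>c. c \<bullet> u)"
    by (intro continuous_intros)
  ultimately obtain d where d: "d \<in> dual_cone K \<inter> sphere 0 1"
    "\<And>c. c \<in> dual_cone K \<inter> sphere 0 1 \<Longrightarrow> d \<bullet> u \<le> c \<bullet> u"
    using continuous_attains_inf[OF _ False, of "\<lambda>c. c \<bullet> u"] by blast
  have m: "0 < d \<bullet> u"
    using d(1) by (intro pos) auto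
  have "norm c \<le> 1 / (d \<bullet> u)" if c: "c \<in> dual_cone K" "c \<bullet> u = 1" for c
  proof -
    have "c \<noteq> 0"
      using c(2) by auto
    then have "d \<bullet> u \<le> ((1 / norm c) *\<^sub>R c) \<bullet> u"
      using dual_cone_scaleR[OF c(1), of "1 / norm c"] by (intro d(2)) simp
    then show ?thesis
      using m c(2) \<open>c \<noteq> 0\<close> by (simp add: field_simps)
  qed
  then have "bounded {c \<in> dual_cone K. c \<bullet> u = 1}"
    by (auto simp: bounded_iff)
  moreover have "{c \<in> dual_cone K. c \<bullet> u = 1} = dual_cone K \<inter> {c. c \<bullet> u = 1}"
    by blast
  moreover have "closed {c. c \<bullet> u = 1}"
    by (intro closed_Collect_eq continuous_intros)
  ultimately show ?thesis
    by (simp add: compact_eq_bounded_closed closed_dual_cone closed_Int)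
qed

text \<open>A splitting of \<open>f\<close> into \<open>c\<close> and \<open>f - c\<close>, both
  nonzero, becomes after normalisation a convex combination of two points of the base with weights
  \<open>s\<close> and \<open>1 - s\<close>. Extremality makes the two points coincide.\<close>

lemma extreme_point_of_base_extremal:
  fixes K :: "'a::euclidean_space set"
  assumes pos: "\<And>c. c \<in> dual_cone K \<Longrightarrow> c \<noteq> 0 \<Longrightarrow> 0 < c \<bullet> u"
    and f: "f extreme_point_of {c \<in> dual_cone K. c \<bullet> u = 1}"
  shows "f \<in> extremal_functionals K"
proof -
  have fK: "f \<in> dual_cone K" "f \<bullet> u = 1"
    using f by (auto simp: extreme_point_of_def)
  have "\<exists>t\<ge>0. c = t *\<^sub>R f" if c: "c \<in> dual_cone K" "f - c \<in> dual_cone K" for c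
  proof (cases "c = 0 \<or> f - c = 0")
    case True
    then have "c = 0 *\<^sub>R f \<or> c = 1 *\<^sub>R f"
      by auto
    then show ?thesis
      using order_refl zero_le_one by blast
  next
    case False
    define s where "s = c \<bullet> u"
    have s: "0 < s" "0 < 1 - s"
      using pos[OF c(1)] pos[OF c(2)] False fK(2) by (auto simp: s_def inner_diff_left)
    define a where "a = (1 / s) *\<^sub>R c"
    define b where "b = (1 / (1 - s)) *\<^sub>R (f - c)"
    have ab: "a \<in> {c \<in> dual_cone K. c \<bullet> u = 1}" "b \<in> {c \<in> dual_cone K. c \<bullet> u = 1}"
      using s fK(2) dual_cone_scaleR[OF c(1), of "1 / s"] dual_cone_scaleR[OF c(2), of "1 / (1 - s)"]
      by (auto simp: a_def b_def s_def inner_diff_left)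
    have comb: "f = (1 - s) *\<^sub>R b + s *\<^sub>R a"
      using s by (simp add: a_def b_def)
    have "a = b"
    proof (rule ccontr)
      assume "a \<noteq> b"
      then have "f \<in> open_segment b a"
        using comb s by (auto simp: in_segment)
      then show False
        using f ab by (auto simp: extreme_point_of_def)
    qed
    then have "f = a"
      using comb by (simp flip: scaleR_left_distrib)
    then have "c = s *\<^sub>R f"
      using s by (simp add: a_def)
    then show ?thesis
      using s by (intro exI[of _ s]) simp
  qed
  then show ?thesis
    using fK by (simp add: extremal_functionals_def)
qed

text \<open>By Krein-Milman the base is the convex hull of its extreme points, so nonnegativity at
  \<open>x\<close> passes from the extremal functionals to the whole dual cone; separation then puts
  \<open>x\<close> into \<open>K\<close>.\<close>

lemma mem_cone_iff_extremal_functionals: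
  fixes K :: "'a::euclidean_space set"
  assumes K: "ordering_cone K" "closed K" "generating K"
  shows "x \<in> K \<longleftrightarrow> (\<forall>f \<in> extremal_functionals K. 0 \<le> f \<bullet> x)"
proof
  show "x \<in> K \<Longrightarrow> \<forall>f \<in> extremal_functionals K. 0 \<le> f \<bullet> x"
    by (auto simp: extremal_functionals_def dual_cone_def)
next
  assume nonneg: "\<forall>f \<in> extremal_functionals K. 0 \<le> f \<bullet> x"
  obtain u where pos: "\<And>c. c \<in> dual_cone K \<Longrightarrow> c \<noteq> 0 \<Longrightarrow> 0 < c \<bullet> u"
    using exists_strictly_positive[OF K(1,3)] by blast
  define P where "P = {c \<in> dual_cone K. c \<bullet> u = 1}"
  have "P = dual_cone K \<inter> {c. u \<bullet> c = 1}"
    by (auto simp: P_def inner_commute)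
  then have "convex P"
    by (simp add: convex_Int convex_dual_cone convex_hyperplane)
  moreover have "compact P"
    unfolding P_def using pos by (rule compact_dual_cone_base)
  ultimately have "P = convex hull {f. f extreme_point_of P}"
    using Krein_Milman_Minkowski by blast
  also have "\<dots> \<subseteq> {c. x \<bullet> c \<ge> 0}"
  proof (rule hull_minimal)
    show "{f. f extreme_point_of P} \<subseteq> {c. x \<bullet> c \<ge> 0}"
      using extreme_point_of_base_extremal[of K u, OF pos] nonneg
      by (auto simp: P_def inner_commute)
  qed (rule convex_halfspace_ge)
  finally have P: "P \<subseteq> {c. x \<bullet> c \<ge> 0}" .
  show "x \<in> K"
  proof (rule ccontr)
    assume "x \<notin> K"
    then obtain c where c: "c \<in> dual_cone K" "c \<bullet> x < 0"
      using dual_cone_separates[OF K(1,2)] by blast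
    have cu: "0 < c \<bullet> u"
      using c by (intro pos) auto
    then have "(1 / (c \<bullet> u)) *\<^sub>R c \<in> P"
      using dual_cone_scaleR[OF c(1), of "1 / (c \<bullet> u)"] by (simp add: P_def)
    then have "0 \<le> x \<bullet> ((1 / (c \<bullet> u)) *\<^sub>R c)"
      using P by blast
    then show False
      using c(2) cu by (simp add: inner_commute zero_le_divide_iff)
  qed
qed

section \<open>Disjointness through extremal functionals\<close>

text \<open>A hyperplane separating \<open>v\<close> from the differences \<open>b - a\<close> of this kind is given by a functional
  that, up to scaling, lies between \<open>0\<close> and \<open>f\<close>; hence it is a multiple of \<open>f\<close>.\<close>
lemma extremal_functional_decomposition:
  fixes K :: "'a::euclidean_space set"
  assumes K: "ordering_cone K" "generating K"
    and f: "f \<in> extremal_functionals K" and v: "0 \<le> f \<bullet> v" and e: "0 < e"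
  shows "\<exists>a\<in>K. v + a \<in> K \<and> f \<bullet> a \<le> e"
proof (rule ccontr)
  assume no: "\<not> ?thesis"
  define T where "T = {b - a - v | a b. a \<in> K \<and> b \<in> K \<and> f \<bullet> a \<le> e}"
  note Ks = ordering_coneD[OF K(1)]
  have fK: "f \<in> dual_cone K"
    using f by (simp add: extremal_functionals_def)
  have "0 \<notin> T"
  proof
    assume "0 \<in> T"
    then obtain a b where "a \<in> K" "b \<in> K" "f \<bullet> a \<le> e" "b - a - v = 0"
      by (auto simp: T_def)
    moreover from this have "v + a = b"
      by (simp add: algebra_simps)
    ultimately show False
      using no by blast
  qed
  moreover have "convex T"
  proof (rule convexI)
    fix x y and s t :: real
    assume "x \<in> T" "y \<in> T" and st: "0 \<le> s" "0 \<le> t" "s + t = 1"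
    then obtain a b a' b' where x: "a \<in> K" "b \<in> K" "f \<bullet> a \<le> e" "x = b - a - v"
      and y: "a' \<in> K" "b' \<in> K" "f \<bullet> a' \<le> e" "y = b' - a' - v"
      by (auto simp: T_def)
    have "s *\<^sub>R x + t *\<^sub>R y = (s *\<^sub>R b + t *\<^sub>R b') - (s *\<^sub>R a + t *\<^sub>R a') - (s + t) *\<^sub>R v"
      by (simp add: x y algebra_simps)
    moreover have "f \<bullet> (s *\<^sub>R a + t *\<^sub>R a') \<le> e"
      using convex_bound_le[OF x(3) y(3) st] by (simp add: inner_add_right)
    moreover have "s *\<^sub>R a + t *\<^sub>R a' \<in> K" "s *\<^sub>R b + t *\<^sub>R b' \<in> K"
      using x y st by (simp_all add: Ks)
    ultimately show "s *\<^sub>R x + t *\<^sub>R y \<in> T"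
      unfolding T_def st(3) scaleR_one by blast
  qed
  ultimately obtain c where c0: "c \<noteq> 0" and "\<And>x. x \<in> T \<Longrightarrow> 0 \<le> c \<bullet> x"
    using separating_hyperplane_set_0[of T] by blast
  then have sep: "c \<bullet> v \<le> c \<bullet> b - c \<bullet> a" if "a \<in> K" "b \<in> K" "f \<bullet> a \<le> e" for a b
  proof -
    have "b - a - v \<in> T"
      using that by (auto simp: T_def)
    then show ?thesis
      using \<open>\<And>x. x \<in> T \<Longrightarrow> 0 \<le> c \<bullet> x\<close> by (force simp: inner_diff_right)
  qed
  \<comment> \<open>With \<open>a = 0\<close>, \<open>sep\<close> bounds \<open>c\<close> below by
    \<open>- M\<close> on \<open>K\<close>; with \<open>b = 0\<close> it bounds \<open>c\<close>
    above by \<open>M\<close> where \<open>f\<close> is at most \<open>e\<close>. Scaling turns the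
    first bound into \<open>cK\<close> and the second into \<open>bound\<close>.\<close>
  define M where "M = - (c \<bullet> v)"
  have M: "0 \<le> M"
    using sep[of 0 0] Ks(1) e by (simp add: M_def)
  have cK: "c \<in> dual_cone K"
  proof -
    have "0 \<le> c \<bullet> b" if b: "b \<in> K" for b
    proof (rule ccontr)
      assume neg: "\<not> 0 \<le> c \<bullet> b"
      define t where "t = (M + 1) / - (c \<bullet> b)"
      have "t *\<^sub>R b \<in> K"
        using neg M b by (intro Ks) (auto simp: t_def divide_simps)
      then have "c \<bullet> v \<le> t * (c \<bullet> b)"
        using sep[of 0 "t *\<^sub>R b"] Ks(1) e by simp
      moreover have "t * (c \<bullet> b) = - (M + 1)"
        using neg by (simp add: t_def)
      ultimately show False
        by (simp add: M_def)
    qed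
    then show ?thesis
      by (simp add: dual_cone_def)
  qed
  have bound: "e * (c \<bullet> a) \<le> M * (f \<bullet> a)" if a: "a \<in> K" for a
  \<comment> \<open>If \<open>f\<close> vanishes at \<open>a\<close>, every nonnegative multiple of
    \<open>a\<close> is admissible in \<open>sep\<close>, so \<open>c\<close> is bounded above on a
    ray; otherwise \<open>a\<close> is rescaled to the level \<open>e\<close> of
    \<open>f\<close>.\<close>
  proof (cases "f \<bullet> a = 0")
    case True
    have "c \<bullet> a \<le> 0"
    proof (rule ccontr)
      assume pos: "\<not> c \<bullet> a \<le> 0"
      define t where "t = (M + 1) / (c \<bullet> a)"
      have "t *\<^sub>R a \<in> K"
        using pos M a by (intro Ks) (auto simp: t_def)
      then have "c \<bullet> v \<le> - (t * (c \<bullet> a))"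
        using sep[of "t *\<^sub>R a" 0] Ks(1) e True by simp
      moreover have "t * (c \<bullet> a) = M + 1"
        using pos by (simp add: t_def)
      ultimately show False
        by (simp add: M_def)
    qed
    then show ?thesis
      using True e by (simp add: mult_le_0_iff)
  next
    case False
    then have fa: "0 < f \<bullet> a"
      using fK a by (force simp: dual_cone_def)
    have "(e / (f \<bullet> a)) *\<^sub>R a \<in> K"
      using fa e a by (intro Ks) auto
    then have "c \<bullet> v \<le> - (e / (f \<bullet> a) * (c \<bullet> a))"
      using sep[of "(e / (f \<bullet> a)) *\<^sub>R a" 0] Ks(1) e fa by simp
    then show ?thesis
      using fa by (simp add: M_def field_simps)
  qed
  have "M \<noteq> 0"
  proof
    assume "M = 0"
    then have "- c \<in> dual_cone K"
      using bound e by (auto simp: dual_cone_def mult_le_0_iff)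
    then show False
      using dual_cone_antisym[OF K(2) cK] c0 by blast
  qed
  with M have M: "0 < M"
    by simp
  have "f - (e / M) *\<^sub>R c \<in> dual_cone K"
    using bound M by (auto simp: dual_cone_def inner_diff_left field_simps)
  moreover have "(e / M) *\<^sub>R c \<in> dual_cone K"
    using M e by (intro dual_cone_scaleR cK) auto
  ultimately obtain t where t: "0 \<le> t" "(e / M) *\<^sub>R c = t *\<^sub>R f"
    using f by (auto simp: extremal_functionals_def)
  \<comment> \<open>Being a nonnegative multiple of \<open>f\<close>, the functional is nonnegative
    at \<open>v\<close>, whereas \<open>M > 0\<close> makes \<open>c\<close> negative there.\<close>
  have "(e / M) * (c \<bullet> v) = t * (f \<bullet> v)"
    using t(2) by (metis inner_scaleR_left)
  then have "0 \<le> (e / M) * (c \<bullet> v)"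
    using t(1) v by simp
  then show False
    using M e by (simp add: M_def zero_le_mult_iff zero_le_divide_iff)
qed

text \<open>If \<open>f\<close> is nonnegative at \<open>w\<close>, decompose
  \<open>2 *\<^sub>R w\<close>: the vector \<open>w + a\<close> exceeds \<open>w\<close> by
  \<open>a\<close> and \<open>- w\<close> by \<open>2 *\<^sub>R w + a\<close>. The other sign
  follows by exchanging \<open>w\<close> and \<open>- w\<close>.\<close>

lemma upper_bound_approximating_abs:
  fixes K :: "'a::euclidean_space set"
  assumes K: "ordering_cone K" "generating K"
    and f: "f \<in> extremal_functionals K" and e: "0 < e"
  shows "\<exists>z \<in> upper_bounds K {w, - w}. f \<bullet> z \<le> \<bar>f \<bullet> w\<bar> + e"
proof -
  have *: "\<exists>z \<in> upper_bounds K {w, - w}. f \<bullet> z \<le> \<bar>f \<bullet> w\<bar> + e" if "0 \<le> f \<bullet> w" for w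
  proof -
    obtain a where a: "a \<in> K" "2 *\<^sub>R w + a \<in> K" "f \<bullet> a \<le> e"
      using extremal_functional_decomposition[OF K f, of "2 *\<^sub>R w" e] \<open>0 \<le> f \<bullet> w\<close> e by auto
    have "w + a \<in> upper_bounds K {w, - w}"
      using a by (simp add: upper_bounds_def cone_le_def scaleR_2 algebra_simps)
    then show ?thesis
      using a(3) that by (intro bexI[of _ "w + a"]) (auto simp: inner_add_right)
  qed
  show ?thesis
    using *[of w] *[of "- w"] by (cases "0 \<le> f \<bullet> w") (auto simp: insert_commute)
qed

lemma upper_bounds_iff_extremal_functionals:
  fixes K :: "'a::euclidean_space set"
  assumes K: "ordering_cone K" "closed K" "generating K"
  shows "z \<in> upper_bounds K {w, - w} \<longleftrightarrow> (\<forall>f \<in> extremal_functionals K. \<bar>f \<bullet> w\<bar> \<le> f \<bullet> z)"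
  by (force simp: upper_bounds_def cone_le_def mem_cone_iff_extremal_functionals[OF K]
      inner_diff_right inner_add_right abs_le_iff)

text \<open>The upper bounds of \<open>w\<close> and \<open>- w\<close> determine, and are
  determined by, the absolute values at \<open>w\<close> of all extremal functionals. So
  disjointness says that each \<open>f\<close> has equal absolute values at \<open>x + y\<close> and
  \<open>x - y\<close>.\<close>

lemma disjoint_elems_iff_extremal_functionals:
  fixes K :: "'a::euclidean_space set"
  assumes K: "ordering_cone K" "closed K" "generating K"
  shows "disjoint_elems K x y \<longleftrightarrow> (\<forall>f \<in> extremal_functionals K. f \<bullet> x = 0 \<or> f \<bullet> y = 0)"
proof -
  have eq: "disjoint_elems K x y \<longleftrightarrow>
      upper_bounds K {x + y, - (x + y)} = upper_bounds K {x - y, - (x - y)}"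
    by (simp add: disjoint_elems_def)
  have abs_eq: "\<bar>p + q\<bar> = \<bar>p - q\<bar> \<longleftrightarrow> p = 0 \<or> q = 0" for p q :: real
    by linarith
  note le = upper_bounds_iff_extremal_functionals[OF K]
  have mono: "\<bar>f \<bullet> w\<bar> \<le> \<bar>f \<bullet> w'\<bar>"
    if sub: "upper_bounds K {w', - w'} \<subseteq> upper_bounds K {w, - w}"
      and f: "f \<in> extremal_functionals K" for f w w'
  proof (rule field_le_epsilon)
    fix e :: real
    assume "0 < e"
    then obtain z where "z \<in> upper_bounds K {w', - w'}" "f \<bullet> z \<le> \<bar>f \<bullet> w'\<bar> + e"
      using upper_bound_approximating_abs[OF K(1,3) f] by blast
    then show "\<bar>f \<bullet> w\<bar> \<le> \<bar>f \<bullet> w'\<bar> + e"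
      using sub f le[of z w] by fastforce
  qed
  have "disjoint_elems K x y \<longleftrightarrow> (\<forall>f \<in> extremal_functionals K. \<bar>f \<bullet> (x + y)\<bar> = \<bar>f \<bullet> (x - y)\<bar>)"
  proof
    show "disjoint_elems K x y \<Longrightarrow> \<forall>f \<in> extremal_functionals K. \<bar>f \<bullet> (x + y)\<bar> = \<bar>f \<bullet> (x - y)\<bar>"
      unfolding eq by (intro ballI order_antisym mono) auto
    show "disjoint_elems K x y" if "\<forall>f \<in> extremal_functionals K. \<bar>f \<bullet> (x + y)\<bar> = \<bar>f \<bullet> (x - y)\<bar>"
      unfolding eq set_eq_iff le using that by simp
  qed
  then show ?thesis
    by (simp add: inner_add_right inner_diff_right abs_eq)
qed

section \<open>Counting bands\<close>

text \<open>While some pair splits \<open>L\<close>, replace \<open>L\<close> by its intersections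
  with the two subspaces, both of smaller dimension. The dimension ends the recursion, so the bound
  does not depend on the size of \<open>I\<close>. \<open>L\<close> is an arbitrary set, as a
  subspace covered by two subspaces already lies in one.\<close>

lemma irreducible_cover:
  fixes L :: "'a::euclidean_space set"
  assumes "\<And>i. i \<in> I \<Longrightarrow> subspace (U i) \<and> subspace (V i) \<and> L \<subseteq> U i \<union> V i"
  shows "\<exists>\<L>. finite \<L> \<and> card \<L> \<le> 2 ^ (dim L - 1) \<and> \<Union>\<L> = L \<and>
           (\<forall>M\<in>\<L>. \<forall>i\<in>I. M \<subseteq> U i \<or> M \<subseteq> V i)"
  using assms
proof (induction "dim L" arbitrary: L rule: less_induct)
  case less
  show ?case
  proof (cases "\<forall>i\<in>I. L \<subseteq> U i \<or> L \<subseteq> V i")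
    case True
    then show ?thesis
      by (intro exI[of _ "{L}"]) auto
  next
    case False
    then obtain i where i: "i \<in> I" "\<not> L \<subseteq> U i" "\<not> L \<subseteq> V i"
      by blast
    have sub: "subspace (U i)" "subspace (V i)" "L \<subseteq> U i \<union> V i"
      using less.prems i(1) by auto
    have dim_less: "dim (L \<inter> S) < dim L" if "subspace S" "\<not> L \<subseteq> S" for S
    proof -
      have "span (L \<inter> S) \<subseteq> S"
        using that(1) by (simp add: span_minimal)
      moreover have "span (L \<inter> S) \<subseteq> span L"
        by (simp add: span_mono)
      ultimately have "span (L \<inter> S) \<subset> span L"
        using that(2) span_superset[of L] by blast
      then show ?thesis
        by (rule dim_psubset)
    qed
    \<comment> \<open>Otherwise \<open>L\<close> would lie in \<open>V i\<close>, which contains 0.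
      Hence a split needs dimension at least 2, which saves one level of the recursion and gives the
      exponent \<open>dim L - 1\<close>.\<close>
    have "dim (L \<inter> U i) \<noteq> 0"
      using i(3) sub subspace_0[OF sub(2)] by (auto simp: dim_eq_0)
    then have two: "2 \<le> dim L"
      using dim_less[OF sub(1) i(2)] by linarith
    have part: "\<exists>\<L>. finite \<L> \<and> card \<L> \<le> 2 ^ (dim L - 2) \<and> \<Union>\<L> = L \<inter> S \<and>
                 (\<forall>M\<in>\<L>. \<forall>i\<in>I. M \<subseteq> U i \<or> M \<subseteq> V i)" if S: "subspace S" "\<not> L \<subseteq> S" for S
    proof -
      obtain \<L> where "finite \<L>" "card \<L> \<le> 2 ^ (dim (L \<inter> S) - 1)" "\<Union>\<L> = L \<inter> S"
        "\<forall>M\<in>\<L>. \<forall>i\<in>I. M \<subseteq> U i \<or> M \<subseteq> V i"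
        using less.hyps[OF dim_less[OF S]] less.prems by (meson inf.coboundedI1)
      moreover have "(2::nat) ^ (dim (L \<inter> S) - 1) \<le> 2 ^ (dim L - 2)"
        using dim_less[OF S] by (intro power_increasing) auto
      ultimately show ?thesis
        by (meson order_trans)
    qed
    obtain \<A> where A: "finite \<A>" "card \<A> \<le> 2 ^ (dim L - 2)" "\<Union>\<A> = L \<inter> U i"
      "\<forall>M\<in>\<A>. \<forall>i\<in>I. M \<subseteq> U i \<or> M \<subseteq> V i"
      using part[OF sub(1) i(2)] by blast
    obtain \<B> where B: "finite \<B>" "card \<B> \<le> 2 ^ (dim L - 2)" "\<Union>\<B> = L \<inter> V i"
      "\<forall>M\<in>\<B>. \<forall>i\<in>I. M \<subseteq> U i \<or> M \<subseteq> V i"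
      using part[OF sub(2) i(3)] by blast
    have "card (\<A> \<union> \<B>) \<le> 2 ^ (dim L - 2) + 2 ^ (dim L - 2)"
      using card_Un_le[of \<A> \<B>] A(2) B(2) by linarith
    also have "\<dots> = 2 ^ Suc (dim L - 2)"
      by simp
    also have "Suc (dim L - 2) = dim L - 1"
      using two by simp
    finally have "card (\<A> \<union> \<B>) \<le> 2 ^ (dim L - 1)" .
    moreover have "\<Union>(\<A> \<union> \<B>) = L"
      using A(3) B(3) sub(3) by blast
    ultimately show ?thesis
      using A B by (intro exI[of _ "\<A> \<union> \<B>"]) blast
  qed
qed

section \<open>Bands as common kernels of extremal functionals\<close>

lemma mem_orthogonal_comp_iff: "f \<in> W\<^sup>\<bottom> \<longleftrightarrow> (\<forall>x\<in>W. f \<bullet> x = 0)"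
  by (auto simp: orthogonal_comp_def orthogonal_def inner_commute)

text \<open>A functional that is nonzero at some element of the disjoint complement of
  \<open>B\<close> must vanish at everything disjoint from that element; one that is zero there
  imposes no condition.\<close>

lemma band_eq_common_kernel:
  fixes K :: "'a::euclidean_space set"
  assumes K: "ordering_cone K" "closed K" "generating K" and B: "band K B"
  shows "B = {x. \<forall>f \<in> extremal_functionals K - (disjoint_complement K B)\<^sup>\<bottom>. f \<bullet> x = 0}"
proof -
  have "B = disjoint_complement K (disjoint_complement K B)"
    using B by (simp add: band_def)
  also have "\<dots> = {x. \<forall>f \<in> extremal_functionals K - (disjoint_complement K B)\<^sup>\<bottom>. f \<bullet> x = 0}"
    by (auto simp: disjoint_complement_def[of K "disjoint_complement K B"]
        disjoint_elems_iff_extremal_functionals[OF K] mem_orthogonal_comp_iff)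
      blast+
  finally show ?thesis .
qed

lemma extremal_functionals_subset_annihilators:
  fixes K :: "'a::euclidean_space set"
  assumes K: "ordering_cone K" "closed K" "generating K"
  shows "extremal_functionals K \<subseteq> B\<^sup>\<bottom> \<union> (disjoint_complement K B)\<^sup>\<bottom>"
  by (auto simp: disjoint_complement_def disjoint_elems_iff_extremal_functionals[OF K]
      mem_orthogonal_comp_iff) blast

lemma card_bands_le:
  fixes K :: "'a::euclidean_space set"
  assumes K: "ordering_cone K" "closed K" "generating K"
  shows "finite {B. band K B} \<and> card {B. band K B} \<le> 2 ^ (2 ^ (DIM('a) - 1))"
proof -
  define E where "E = extremal_functionals K"
  define D where "D = disjoint_complement K"
  obtain \<L> where L: "finite \<L>" "card \<L> \<le> 2 ^ (dim E - 1)" "\<Union>\<L> = E"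
    "\<And>M B. M \<in> \<L> \<Longrightarrow> band K B \<Longrightarrow> M \<subseteq> B\<^sup>\<bottom> \<or> M \<subseteq> (D B)\<^sup>\<bottom>"
    using irreducible_cover[of "{B. band K B}" "\<lambda>B. B\<^sup>\<bottom>" "\<lambda>B. (D B)\<^sup>\<bottom>" E]
      extremal_functionals_subset_annihilators[OF K]
    by (auto simp: E_def D_def subspace_orthogonal_comp)
  \<comment> \<open>The code of a band: a subset of the fixed finite family \<open>\<L>\<close> from
    which the band can be recovered.\<close>
  define J where "J B = {M \<in> \<L>. \<not> M \<subseteq> (D B)\<^sup>\<bottom>}" for B
  have kernel: "B = {x. \<forall>f \<in> \<Union>(J B). f \<bullet> x = 0}" if B: "band K B" for B
  proof
    show "B \<subseteq> {x. \<forall>f \<in> \<Union>(J B). f \<bullet> x = 0}"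
      \<comment> \<open>A piece of \<open>J B\<close> is not in the annihilator of
        \<open>D B\<close>, so it lies in that of \<open>B\<close>.\<close>
      using L(4)[OF _ B] by (fastforce simp: J_def mem_orthogonal_comp_iff)
    have "E - (D B)\<^sup>\<bottom> \<subseteq> \<Union>(J B)"
      using L(3) by (auto simp: J_def)
    then show "{x. \<forall>f \<in> \<Union>(J B). f \<bullet> x = 0} \<subseteq> B"
      using band_eq_common_kernel[OF K B] unfolding E_def D_def by blast
  qed
  have inj: "inj_on J {B. band K B}"
  proof (rule inj_onI)
    fix B B'
    assume "B \<in> {B. band K B}" "B' \<in> {B. band K B}" "J B = J B'"
    then show "B = B'"
      using kernel[of B] kernel[of B'] by simp
  qed
  have range: "J ` {B. band K B} \<subseteq> Pow \<L>"
    by (auto simp: J_def)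
  have "finite {B. band K B}"
    using inj_on_finite[OF inj range] L(1) by simp
  moreover have "card {B. band K B} \<le> 2 ^ (2 ^ (DIM('a) - 1))"
  proof -
    have "card {B. band K B} \<le> 2 ^ card \<L>"
      using card_inj_on_le[OF inj range] L(1) by (simp add: card_Pow)
    also have "card \<L> \<le> 2 ^ (DIM('a) - 1)"
      using L(2) power_increasing[of "dim E - 1" "DIM('a) - 1" "2::nat"] dim_subset_UNIV[of E]
      by (meson diff_le_mono le_trans one_le_numeral)
    then have "(2::nat) ^ card \<L> \<le> 2 ^ (2 ^ (DIM('a) - 1))"
      by (intro power_increasing) auto
    finally show ?thesis .
  qed
  ultimately show ?thesis
    by blast
qed

theorem theorem28:
  fixes K :: "'a::euclidean_space set" and n :: nat
  assumes "n \<ge> 2"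
    and "DIM('a) = n"
    and "ordering_cone K"
    and "closed K"
    and "generating K"
  shows "finite {B. band K B} \<and> real (card {B. band K B}) \<le> 1 / 4 * 2 ^ (2 ^ n)"
proof -
  note bands = card_bands_le[OF assms(3-5), unfolded assms(2)]
  obtain m where m: "n = Suc (Suc m)"
    using assms(1) by (metis add_2_eq_Suc le_Suc_ex)
  \<comment> \<open>Since \<open>n \<ge> 2\<close>, doubling \<open>2 ^ (n - 1)\<close> adds at
    least 2 to the exponent, which pays for the factor 1/4.\<close>
  have "2 ^ (n - 1) + 2 \<le> (2::nat) ^ n"
    using one_le_power[of "2::nat" m] by (simp add: m)
  then have "(2::real) ^ (2 ^ (n - 1) + 2) \<le> 2 ^ (2 ^ n)"
    by (intro power_increasing) auto
  moreover have "real (card {B. band K B}) \<le> 2 ^ (2 ^ (n - 1))"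
    using bands by (metis of_nat_le_iff of_nat_numeral of_nat_power)
  ultimately have "real (card {B. band K B}) \<le> 1 / 4 * 2 ^ (2 ^ n)"
    unfolding power_add power2_eq_square by linarith
  then show ?thesis
    using bands by blast
qed

end
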